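(* Let $\emptyset\neq\mathcal{A}\subseteq\mathbb{R}^n$ and $\mathcal{B}\subseteq\mathbb{N}^n\setminus(2\mathbb{N})^n$ be finite sets and let $f=\sum_{\alpha\in\mathcal{A}}c_\alpha|x|^\alpha+\sum_{\beta\in\mathcal{B}}d_\beta x^\beta\in\mathbb{R}[\mathcal{A},\mathcal{B}]$. Assume that (1) $\operatorname{conv}(\mathcal{A})$ is a simplex and $\mathcal{B}\subseteq\operatorname{conv}(\mathcal{A})$, (2) $c_\alpha\le0$ for every $\alpha\in\mathcal{A}$ which is not a vertex of $\operatorname{conv}(\mathcal{A})$, and (3) $d_\beta\le0$ for every $\beta\in\mathcal{B}$. Then $f$ is non-negative if and only if $f\in C_{\mathcal{S}}(\mathcal{A},\mathcal{B})$. In this case, $f$ can be written as a sum of circuit functions using only vertices of $\operatorname{conv}(\mathcal{A})$ as outer exponents.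
   Context: $\mathbb{N}=\{0,1,2,\ldots\}$. For $x\in\mathbb{R}^n$, $\alpha\in\mathbb{R}^n$, $\beta\in\mathbb{N}^n$ put $|x|^\alpha=\prod_j|x_j|^{\alpha_j}$ and $x^\beta=\prod_j x_j^{\beta_j}$; if a component of $x$ is zero and the corresponding exponent is negative, then $|x|^\alpha=\infty$. For finite sets $\emptyset\neq\mathcal{A}\subseteq\mathbb{R}^n$ and $\mathcal{B}\subseteq\mathbb{N}^n\setminus(2\mathbb{N})^n$ (not necessarily disjoint), $\mathbb{R}[\mathcal{A},\mathcal{B}]$ is the real vector space, of dimension $|\mathcal{A}|+|\mathcal{B}|$, of all functions $f=\sum_{\alpha\in\mathcal{A}}c_\alpha|x|^\alpha+\sum_{\beta\in\mathcal{B}}d_\beta x^\beta$ with real coefficients. Such an $f$ is viewed as a function $\mathbb{R}^n\to\mathbb{R}\cup\{\infty\}$, with value $\infty$ at points where some monomial occurring in $f$ with nonzero coefficient is $\infty$; $f$ is non-negative if $f(x)\ge0$ for all $x\in\mathbb{R}^n$. Such an $f$ is an even AG function if at most one $c_\alpha$ is negative and all $d_\beta$ are zero; it is an odd AG function if all $c_\alpha$ are non-negative and at most one $d_\beta$ is nonzero; it is an AG function if it is an even or an odd AG function. The $\mathcal{S}$-cone $C_{\mathcal{S}}(\mathcal{A},\mathcal{B})$ is the conic hull (set of all finite non-negative linear combinations, including $0$) of the non-negative AG functions in $\mathbb{R}[\mathcal{A},\mathcal{B}]$. A circuit is a pair $(A,\beta)$ with $A\subseteq\mathbb{R}^n$ affinely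 independent and $\beta\in\operatorname{relint}\operatorname{conv}(A)$ (singletons $A=\{\beta\}$ are allowed). An even circuit function supported on $(A,\beta)$ is an AG function $\sum_{\alpha\in A}c_\alpha|x|^\alpha+d|x|^\beta$ with $c_\alpha>0$ for all $\alpha\in A$ and $d\in\mathbb{R}$; for $\beta\in\mathbb{N}^n\setminus(2\mathbb{N})^n$, an odd circuit function supported on $(A,\beta)$ is an AG function $\sum_{\alpha\in A}c_\alpha|x|^\alpha+d x^\beta$ with $c_\alpha>0$ for all $\alpha\in A$ and $d\in\mathbb{R}$. A circuit function is an even or odd circuit function; $\beta$ is its inner exponent and the elements of $A$ are its outer exponents. *)

theory Defs
  imports "HOL-Analysis.Analysis"
begin

(* An element of R[A,B] is represented by its pair of coefficient functions (c, d): c for the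
   monomials |x|^a, d for the monomials x^b.  Two separate functions are needed because a vector
   may be an exponent of both kinds.  The vector space structure is that of the coefficients, so
   that the dimension of R[A,B] is |A| + |B|; pointwise addition of the extended-real-valued
   functions would not allow infinite monomials to cancel. *)
type_synonym 'n signomial = "(real^'n \<Rightarrow> real) \<times> (nat^'n \<Rightarrow> real)"

definition real_vec :: "nat^'n \<Rightarrow> real^'n"
  where "real_vec b = (\<chi> j. real (b $ j))"

(* The case distinction on a zero exponent implements 0^0 = 1, since 0 powr 0 = 0. *)
definition abs_monom :: "real^'n \<Rightarrow> real^'n \<Rightarrow> ereal"
  where "abs_monom x a =
    (if \<exists>j. x $ j = 0 \<and> a $ j < 0 then \<infinity>
     else ereal (\<Prod>j\<in>UNIV. if a $ j = 0 then 1 else \<bar>x $ j\<bar> powr (a $ j)))"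

definition nat_monom :: "real^'n \<Rightarrow> nat^'n \<Rightarrow> real"
  where "nat_monom x b = (\<Prod>j\<in>UNIV. (x $ j) ^ (b $ j))"

definition signomials :: "(real^'n) set \<Rightarrow> (nat^'n) set \<Rightarrow> ('n::finite) signomial set"
  where "signomials A B =
    {f. (\<forall>a. a \<notin> A \<longrightarrow> fst f a = 0) \<and> (\<forall>b. b \<notin> B \<longrightarrow> snd f b = 0)}"

(* Meaningful for finitely supported f, in particular on signomials A B with A and B finite. *)
definition sig_val :: "('n::finite) signomial \<Rightarrow> real^'n \<Rightarrow> ereal"
  where "sig_val f x =
    (if \<exists>a. fst f a \<noteq> 0 \<and> abs_monom x a = \<infinity> then \<infinity>
     else ereal ((\<Sum>a | fst f a \<noteq> 0. fst f a * real_of_ereal (abs_monom x a))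
               + (\<Sum>b | snd f b \<noteq> 0. snd f b * nat_monom x b)))"

definition sig_nonneg :: "('n::finite) signomial \<Rightarrow> bool"
  where "sig_nonneg f \<longleftrightarrow> (\<forall>x. 0 \<le> sig_val f x)"

definition even_AG :: "('n::finite) signomial \<Rightarrow> bool"
  where "even_AG f \<longleftrightarrow>
    (\<forall>a a'. fst f a < 0 \<and> fst f a' < 0 \<longrightarrow> a = a') \<and> (\<forall>b. snd f b = 0)"

definition odd_AG :: "('n::finite) signomial \<Rightarrow> bool"
  where "odd_AG f \<longleftrightarrow>
    (\<forall>a. 0 \<le> fst f a) \<and> (\<forall>b b'. snd f b \<noteq> 0 \<and> snd f b' \<noteq> 0 \<longrightarrow> b = b')"

definition AG_function :: "('n::finite) signomial \<Rightarrow> bool"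
  where "AG_function f \<longleftrightarrow> even_AG f \<or> odd_AG f"

definition sig_lincomb :: "nat \<Rightarrow> (nat \<Rightarrow> real) \<Rightarrow> (nat \<Rightarrow> ('n::finite) signomial) \<Rightarrow> ('n::finite) signomial"
  where "sig_lincomb k l g =
    (\<lambda>a. \<Sum>i<k. l i * fst (g i) a, \<lambda>b. \<Sum>i<k. l i * snd (g i) b)"

definition S_cone :: "(real^'n) set \<Rightarrow> (nat^'n) set \<Rightarrow> ('n::finite) signomial set"
  where "S_cone A B = {sig_lincomb k l g | k l g.
    \<forall>i<k. 0 \<le> l i \<and> g i \<in> signomials A B \<and> AG_function (g i) \<and> sig_nonneg (g i)}"

definition is_circuit :: "(real^'n) set \<Rightarrow> real^'n \<Rightarrow> bool"
  where "is_circuit A b \<longleftrightarrow> \<not> affine_dependent A \<and> b \<in> rel_interior (convex hull A)"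

(* If A = {b}, the inner and the outer coefficient add up. *)
definition even_circuit_function :: "(real^'n) set \<Rightarrow> real^'n \<Rightarrow> ('n::finite) signomial \<Rightarrow> bool"
  where "even_circuit_function A b f \<longleftrightarrow> is_circuit A b \<and> AG_function f \<and>
    (\<exists>c d. (\<forall>a\<in>A. 0 < c a) \<and>
      f = (\<lambda>a. (if a \<in> A then c a else 0) + (if a = b then d else 0), \<lambda>_. 0))"

definition odd_circuit_function :: "(real^'n) set \<Rightarrow> nat^'n \<Rightarrow> ('n::finite) signomial \<Rightarrow> bool"
  where "odd_circuit_function A b f \<longleftrightarrow> is_circuit A (real_vec b) \<and> (\<exists>j. odd (b $ j)) \<and>
    AG_function f \<and>
    (\<exists>c d. (\<forall>a\<in>A. 0 < c a) \<and>
      f = (\<lambda>a. if a \<in> A then c a else 0, \<lambda>b'. if b' = b then d else 0))"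

definition circuit_function :: "(real^'n) set \<Rightarrow> real^'n \<Rightarrow> ('n::finite) signomial \<Rightarrow> bool"
  where "circuit_function A b f \<longleftrightarrow> even_circuit_function A b f \<or>
    (\<exists>b'. b = real_vec b' \<and> odd_circuit_function A b' f)"

end

theory Submission
  imports Defs
begin

text \<open>The equivalence and the decomposition rest on a convexity argument that treats all negative terms
  of \<open>f\<close> at once.

  Let \<open>C\<close> be the vertex set of the simplex. Every other exponent is a convex combination of \<open>C\<close>, so at
  a positive point its monomial is a weighted geometric mean of the vertex monomials. As \<open>C\<close> is
  affinely independent, the vertex monomials take arbitrary positive values up to a common factor,
  and this factor is irrelevant by homogeneity. Hence non-negativity of \<open>f\<close> says that the linear
  function \<open>p \<mapsto> \<Sum>v\<in>C. fst f v * p v\<close> dominates a sum of non-negative multiples of weighted geometric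
  means on the non-negative orthant (\<open>sig_nonneg_imp_geo_mean_le\<close>). The signs of the coefficients are
  essential here: at positive points all inner terms are non-positive.

  Weighted geometric means are superlinear (\<open>superlinear_geo_mean\<close>), and a linear majorant of a sum of
  superlinear functions splits into linear majorants of the summands
  (\<open>distribute_linear_majorant\<close>, an instance of the Hahn--Banach theorem). Each linear majorant of one
  mean, restricted to the vertices that occur in the mean and taken together with the negative term
  that the mean stands for, is a circuit function with outer exponents in \<open>C\<close>.
  It is non-negative on the whole space, signs and zeros of \<open>x\<close> included
  (\<open>even_circuit_nonneg\<close>, \<open>odd_circuit_nonneg\<close>). The rest consists of non-negative
  multiples of vertex monomials.

  Conversely, elements of the cone are non-negative. This is not immediate at points with zero
  entries, because infinite monomials of the summands can cancel in the sum; there it follows by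
  approximation (\<open>sig_nonneg_lincomb\<close>).\<close>

section \<open>Splitting linear majorants of superlinear functions\<close>

text \<open>The Hahn--Banach theorem for functions of finitely many variables. The lower
  boundary of the cone \<open>K\<close> is a sublinear function of the first component; it is finite because no
  point over \<open>0\<close> lies below height \<open>0\<close>. The conclusion is a linear function below it. The coefficients of \<open>m\<close> are chosen one coordinate
  at a time: the slope in direction \<open>x\<close> has to lie between the numbers \<open>- z\<close> with \<open>z\<close> above the
  vector \<open>-x\<close> and the numbers \<open>z'\<close> with \<open>z'\<close> above the vector \<open>x\<close>, and adding two such points of \<open>K\<close>
  shows that there is room. Subtracting this slope removes the coordinate. Vectors
  are compared on \<open>V\<close> only, so that removing a coordinate shrinks \<open>V\<close> and leaves their type alone.\<close>
lemma linear_minorant_of_convex_cone: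
  fixes K :: "(('a \<Rightarrow> real) \<times> real) set"
  assumes "finite V"
    and "\<And>u z u' z'. (u, z) \<in> K \<Longrightarrow> (u', z') \<in> K \<Longrightarrow> (\<lambda>v. u v + u' v, z + z') \<in> K"
    and "\<And>r u z. 0 < r \<Longrightarrow> (u, z) \<in> K \<Longrightarrow> (\<lambda>v. r * u v, r * z) \<in> K"
    and "\<And>v t. v \<in> V \<Longrightarrow> t \<in> {-1, 1} \<Longrightarrow> \<exists>u z. (u, z) \<in> K \<and> u v = t \<and> (\<forall>w\<in>V - {v}. u w = 0)"
    and "\<And>u z. (u, z) \<in> K \<Longrightarrow> \<forall>v\<in>V. u v = 0 \<Longrightarrow> 0 \<le> z"
  shows "\<exists>m. \<forall>u z. (u, z) \<in> K \<longrightarrow> (\<Sum>v\<in>V. m v * u v) \<le> z"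
  using assms
proof (induction V arbitrary: K)
  case empty
  then show ?case by auto
next
  case (insert x V)
  note add = insert.prems(1) and scale = insert.prems(2)
    and total = insert.prems(3) and nonneg = insert.prems(4)
  define S where "S t = {z. \<exists>u. (u, z) \<in> K \<and> u x = t \<and> (\<forall>w\<in>V. u w = 0)}" for t
  have ne: "S t \<noteq> {}" if "t \<in> {-1, 1}" for t
    using total[of x t] that insert.hyps(2) unfolding S_def by fastforce
  have opposite: "0 \<le> z + z'" if z: "z \<in> S (-1)" and z': "z' \<in> S 1" for z z'
  proof -
    obtain u where u: "(u, z) \<in> K" "u x = -1" "\<forall>w\<in>V. u w = 0"
      using z unfolding S_def by auto
    obtain u' where u': "(u', z') \<in> K" "u' x = 1" "\<forall>w\<in>V. u' w = 0"
      using z' unfolding S_def by auto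
    show ?thesis using nonneg[OF add[OF u(1) u'(1)]] u u' by auto
  qed
  obtain z1 where z1: "z1 \<in> S 1" using ne[of 1] by auto
  define m0 where "m0 = Sup (uminus ` S (-1))"
  have bdd: "bdd_above (uminus ` S (-1))"
    using opposite[OF _ z1] by (intro bdd_aboveI[of _ z1]) force
  have lower: "- z \<le> m0" if "z \<in> S (-1)" for z
    unfolding m0_def using bdd that by (intro cSup_upper) auto
  have upper: "m0 \<le> z" if "z \<in> S 1" for z
    unfolding m0_def using ne[of "-1"] opposite[OF _ that]
    by (intro cSup_least) force+
  (* The points of K over the whole x-axis reduce to S (-1) and S 1 by scaling. *)
  have m0: "u x * m0 \<le> z" if uz: "(u, z) \<in> K" "\<forall>w\<in>V. u w = 0" for u z
  proof -
    consider "u x = 0" | "u x > 0" | "u x < 0" by linarith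
    then show ?thesis
    proof cases
      case 1
      then show ?thesis using nonneg[OF uz(1)] uz(2) by auto
    next
      case 2
      then have "(1 / u x) * z \<in> S 1"
        using scale[OF _ uz(1), of "1 / u x"] uz(2) unfolding S_def by force
      from upper[OF this] show ?thesis using 2 by (simp add: field_simps)
    next
      case 3
      then have "(1 / - u x) * z \<in> S (-1)"
        using scale[OF _ uz(1), of "1 / - u x"] uz(2) unfolding S_def by force
      from lower[OF this] show ?thesis using 3 by (simp add: field_simps)
    qed
  qed
  define K' where "K' = {(u, z - u x * m0) | u z. (u, z) \<in> K}"
  have "\<exists>m. \<forall>u z. (u, z) \<in> K' \<longrightarrow> (\<Sum>v\<in>V. m v * u v) \<le> z"
  proof (rule insert.IH)
    fix u z u' z' assume "(u, z) \<in> K'" "(u', z') \<in> K'"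
    then obtain y y' where "(u, y) \<in> K" "z = y - u x * m0" "(u', y') \<in> K" "z' = y' - u' x * m0"
      unfolding K'_def by auto
    then show "(\<lambda>v. u v + u' v, z + z') \<in> K'"
      unfolding K'_def using add[of u y u' y']
      by (intro CollectI exI[of _ "\<lambda>v. u v + u' v"] exI[of _ "y + y'"]) (auto simp: algebra_simps)
  next
    fix r :: real and u z assume "0 < r" "(u, z) \<in> K'"
    then obtain y where "(u, y) \<in> K" "z = y - u x * m0"
      unfolding K'_def by auto
    then show "(\<lambda>v. r * u v, r * z) \<in> K'"
      unfolding K'_def using scale[of r u y] \<open>0 < r\<close>
      by (intro CollectI exI[of _ "\<lambda>v. r * u v"] exI[of _ "r * y"]) (auto simp: algebra_simps)
  next
    fix v and t :: real assume "v \<in> V" "t \<in> {-1, 1}"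
    then obtain u z where "(u, z) \<in> K" "u v = t" "\<forall>w\<in>insert x V - {v}. u w = 0"
      using total[of v t] by blast
    then show "\<exists>u z. (u, z) \<in> K' \<and> u v = t \<and> (\<forall>w\<in>V - {v}. u w = 0)"
      unfolding K'_def by (intro exI[of _ u] exI[of _ "z - u x * m0"]) auto
  next
    fix u z assume "(u, z) \<in> K'" "\<forall>v\<in>V. u v = 0"
    then show "0 \<le> z" using m0 unfolding K'_def by force
  qed
  then obtain m where m: "\<And>u z. (u, z) \<in> K' \<Longrightarrow> (\<Sum>v\<in>V. m v * u v) \<le> z" by blast
  show ?case
  proof (intro exI allI impI)
    fix u z assume "(u, z) \<in> K"
    then have "(u, z - u x * m0) \<in> K'" unfolding K'_def by auto
    from m[OF this] have "(\<Sum>v\<in>V. m v * u v) \<le> z - u x * m0" .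
    moreover have "(\<Sum>v\<in>V. (m(x := m0)) v * u v) = (\<Sum>v\<in>V. m v * u v)"
      using insert.hyps(2) by (intro sum.cong) auto
    ultimately show "(\<Sum>v\<in>insert x V. (m(x := m0)) v * u v) \<le> z"
      using insert.hyps by (simp add: algebra_simps)
  qed
qed

text \<open>These are the concave positively homogeneous functions on the non-negative orthant. Values
  outside the orthant are left free.\<close>
definition superlinear :: "(('a \<Rightarrow> real) \<Rightarrow> real) \<Rightarrow> bool"
  where "superlinear h \<longleftrightarrow>
    (\<forall>p q. (\<forall>v. 0 \<le> p v) \<longrightarrow> (\<forall>v. 0 \<le> q v) \<longrightarrow> h p + h q \<le> h (\<lambda>v. p v + q v)) \<and>
    (\<forall>r p. 0 < r \<longrightarrow> (\<forall>v. 0 \<le> p v) \<longrightarrow> h (\<lambda>v. r * p v) = r * h p)"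

lemma superlinear_sum:
  assumes "\<And>i. i \<in> I \<Longrightarrow> superlinear (h i)"
  shows "superlinear (\<lambda>p. \<Sum>i\<in>I. h i p)"
  using assms unfolding superlinear_def
  by (auto simp: sum_distrib_left sum.distrib[symmetric] intro!: sum_mono sum.cong)

lemma superlinear_mult:
  assumes "0 \<le> g" "superlinear h"
  shows "superlinear (\<lambda>p. g * h p)"
  using assms unfolding superlinear_def
  by (auto simp: distrib_left[symmetric] intro!: mult_left_mono)

text \<open>A sandwich theorem: a linear function \<open>m\<close> is to be found between the superlinear \<open>h\<close> and the
  sublinear \<open>c - k\<close>. The functions live on an orthant only, so their inequalities are encoded in one
  cone over differences \<open>q - p\<close> of points of the orthant, with the values above the difference
  \<open>(c - k) q - h p\<close>; a linear minorant of that cone is below \<open>c - k\<close> (take \<open>p = 0\<close>) and above \<open>h\<close>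
  (take \<open>q = 0\<close>).\<close>
lemma split_linear_majorant:
  fixes c :: "'a \<Rightarrow> real"
  assumes V: "finite V" and h: "superlinear h" and k: "superlinear k"
    and dep: "\<And>p q. (\<forall>v\<in>V. p v = q v) \<Longrightarrow> h p = h q"
       "\<And>p q. (\<forall>v\<in>V. p v = q v) \<Longrightarrow> k p = k q"
    and le: "\<And>p. \<forall>v. 0 \<le> p v \<Longrightarrow> h p + k p \<le> (\<Sum>v\<in>V. c v * p v)"
  obtains m where "\<And>p. \<forall>v. 0 \<le> p v \<Longrightarrow> h p \<le> (\<Sum>v\<in>V. m v * p v)"
    and "\<And>p. \<forall>v. 0 \<le> p v \<Longrightarrow> k p \<le> (\<Sum>v\<in>V. (c v - m v) * p v)"
proof -
  let ?s = "\<lambda>p. (\<Sum>v\<in>V. c v * p v) - k p"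
  define K where "K = {(\<lambda>v. q v - p v, z) | p q z. (\<forall>v. 0 \<le> p v) \<and> (\<forall>v. 0 \<le> q v) \<and> ?s q - h p \<le> z}"
  have hadd: "h p + h q \<le> h (\<lambda>v. p v + q v)" and kadd: "k p + k q \<le> k (\<lambda>v. p v + q v)"
    if "\<forall>v. 0 \<le> p v" "\<forall>v. 0 \<le> q v" for p q
    using that h k unfolding superlinear_def by auto
  have hscale: "h (\<lambda>v. r * p v) = r * h p" and kscale: "k (\<lambda>v. r * p v) = r * k p"
    if "\<forall>v. 0 \<le> p v" "0 < r" for p r
    using that h k unfolding superlinear_def by auto
  have zero: "h (\<lambda>v. 0) = 0" "k (\<lambda>v. 0) = 0"
    using hscale[of "\<lambda>v. 0" 2] kscale[of "\<lambda>v. 0" 2] by auto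
  have "\<exists>m. \<forall>u z. (u, z) \<in> K \<longrightarrow> (\<Sum>v\<in>V. m v * u v) \<le> z"
  proof (rule linear_minorant_of_convex_cone[OF V])
    fix u z u' z' assume "(u, z) \<in> K" "(u', z') \<in> K"
    then obtain p q p' q' where
      1: "u = (\<lambda>v. q v - p v)" "\<forall>v. 0 \<le> p v" "\<forall>v. 0 \<le> q v" "?s q - h p \<le> z" and
      2: "u' = (\<lambda>v. q' v - p' v)" "\<forall>v. 0 \<le> p' v" "\<forall>v. 0 \<le> q' v" "?s q' - h p' \<le> z'"
      unfolding K_def by blast
    have "?s (\<lambda>v. q v + q' v) - h (\<lambda>v. p v + p' v) \<le> z + z'"
      using hadd[OF 1(2) 2(2)] kadd[OF 1(3) 2(3)] 1(4) 2(4)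
      by (simp add: algebra_simps sum.distrib)
    then show "(\<lambda>v. u v + u' v, z + z') \<in> K"
      unfolding K_def using 1(1-3) 2(1-3)
      by (intro CollectI exI[of _ "\<lambda>v. p v + p' v"] exI[of _ "\<lambda>v. q v + q' v"]
          exI[of _ "z + z'"]) auto
  next
    fix r :: real and u z assume r: "0 < r" and "(u, z) \<in> K"
    then obtain p q where
      1: "u = (\<lambda>v. q v - p v)" "\<forall>v. 0 \<le> p v" "\<forall>v. 0 \<le> q v" "?s q - h p \<le> z"
      unfolding K_def by blast
    have "?s (\<lambda>v. r * q v) - h (\<lambda>v. r * p v) = r * (?s q - h p)"
      by (simp add: hscale[OF 1(2) r] kscale[OF 1(3) r] algebra_simps sum_distrib_left)
    also have "\<dots> \<le> r * z" using 1(4) r by (intro mult_left_mono) auto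
    finally show "(\<lambda>v. r * u v, r * z) \<in> K"
      unfolding K_def using 1(1-3) r
      by (intro CollectI exI[of _ "\<lambda>v. r * p v"] exI[of _ "\<lambda>v. r * q v"]
          exI[of _ "r * z"]) (auto simp: algebra_simps)
  next
    fix x and t :: real assume "x \<in> V" "t \<in> {-1, 1}"
    define p q where "p v = (if v = x \<and> t = -1 then 1 else 0 :: real)"
      and "q v = (if v = x \<and> t = 1 then 1 else 0 :: real)" for v
    have "(\<lambda>v. q v - p v, ?s q - h p) \<in> K" unfolding K_def p_def q_def by fastforce
    moreover have "q x - p x = t" "\<forall>w\<in>V - {x}. q w - p w = 0"
      using \<open>t \<in> {-1, 1}\<close> by (auto simp: p_def q_def)
    ultimately show "\<exists>u z. (u, z) \<in> K \<and> u x = t \<and> (\<forall>w\<in>V - {x}. u w = 0)" by blast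
  next
    fix u z assume "(u, z) \<in> K" and u0: "\<forall>v\<in>V. u v = 0"
    then obtain p q where
      1: "u = (\<lambda>v. q v - p v)" "\<forall>v. 0 \<le> p v" "\<forall>v. 0 \<le> q v" "?s q - h p \<le> z"
      unfolding K_def by blast
    have "h p = h q" using 1(1) u0 by (intro dep) auto
    then show "0 \<le> z" using le[OF 1(3)] 1(4) by simp
  qed
  then obtain m where m: "\<And>u z. (u, z) \<in> K \<Longrightarrow> (\<Sum>v\<in>V. m v * u v) \<le> z" by blast
  show ?thesis
  proof
    fix p :: "'a \<Rightarrow> real" assume p: "\<forall>v. 0 \<le> p v"
    have "(\<lambda>v. 0 - p v, ?s (\<lambda>v. 0) - h p) \<in> K" unfolding K_def using p by fastforce
    from m[OF this] show "h p \<le> (\<Sum>v\<in>V. m v * p v)" by (simp add: zero sum_negf)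
    have "(\<lambda>v. p v - 0, ?s p - h (\<lambda>v. 0)) \<in> K" unfolding K_def using p by fastforce
    from m[OF this] show "k p \<le> (\<Sum>v\<in>V. (c v - m v) * p v)"
      by (simp add: zero algebra_simps sum_subtractf)
  qed
qed

text \<open>Splitting off one summand at a time leaves a linear function that is non-negative on the
  orthant, hence has non-negative coefficients. This remainder is the reason for the inequality,
  instead of an equality, between the coefficients.\<close>
lemma distribute_linear_majorant:
  fixes c :: "'a \<Rightarrow> real"
  assumes V: "finite V" and "finite I"
    and "\<And>i. i \<in> I \<Longrightarrow> superlinear (h i)"
    and "\<And>i p q. i \<in> I \<Longrightarrow> (\<forall>v\<in>V. p v = q v) \<Longrightarrow> h i p = h i q"
    and "\<And>p. \<forall>v. 0 \<le> p v \<Longrightarrow> (\<Sum>i\<in>I. h i p) \<le> (\<Sum>v\<in>V. c v * p v)"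
  shows "\<exists>m. (\<forall>i\<in>I. \<forall>p. (\<forall>v. 0 \<le> p v) \<longrightarrow> h i p \<le> (\<Sum>v\<in>V. m i v * p v)) \<and>
    (\<forall>v\<in>V. (\<Sum>i\<in>I. m i v) \<le> c v)"
  using assms(2-)
proof (induction I arbitrary: c)
  case empty
  have "0 \<le> c v" if "v \<in> V" for v
    using empty(3)[of "\<lambda>w. if w = v then 1 else 0"] V that by (simp add: if_distrib cong: if_cong)
  then show ?case by auto
next
  case (insert x I)
  obtain m where m: "\<And>p. \<forall>v. 0 \<le> p v \<Longrightarrow> h x p \<le> (\<Sum>v\<in>V. m v * p v)"
    "\<And>p. \<forall>v. 0 \<le> p v \<Longrightarrow> (\<Sum>i\<in>I. h i p) \<le> (\<Sum>v\<in>V. (c v - m v) * p v)"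
  proof (rule split_linear_majorant[OF V, of "h x" "\<lambda>p. \<Sum>i\<in>I. h i p" c])
    show "superlinear (\<lambda>p. \<Sum>i\<in>I. h i p)"
      using insert.prems by (intro superlinear_sum) auto
    show "h x p + (\<Sum>i\<in>I. h i p) \<le> (\<Sum>v\<in>V. c v * p v)" if "\<forall>v. 0 \<le> p v" for p
      using insert.prems(3)[OF that] insert.hyps by simp
  qed (use insert.prems in \<open>auto intro!: sum.cong\<close>)
  have "\<exists>m'. (\<forall>i\<in>I. \<forall>p. (\<forall>v. 0 \<le> p v) \<longrightarrow> h i p \<le> (\<Sum>v\<in>V. m' i v * p v)) \<and>
    (\<forall>v\<in>V. (\<Sum>i\<in>I. m' i v) \<le> c v - m v)"
    by (rule insert.IH) (use insert.prems m in auto)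
  then obtain m' where m': "\<forall>i\<in>I. \<forall>p. (\<forall>v. 0 \<le> p v) \<longrightarrow> h i p \<le> (\<Sum>v\<in>V. m' i v * p v)"
    "\<forall>v\<in>V. (\<Sum>i\<in>I. m' i v) \<le> c v - m v" by blast
  have "(\<Sum>i\<in>I. (m'(x := m)) i v) = (\<Sum>i\<in>I. m' i v)" for v
    using insert.hyps(2) by (intro sum.cong) auto
  then have "\<forall>v\<in>V. (\<Sum>i\<in>insert x I. (m'(x := m)) i v) \<le> c v"
    using m'(2) insert.hyps by fastforce
  moreover have "\<forall>i\<in>insert x I. \<forall>p. (\<forall>v. 0 \<le> p v) \<longrightarrow> h i p \<le> (\<Sum>v\<in>V. (m'(x := m)) i v * p v)"
    using m'(1) m(1) by auto
  ultimately show ?case by blast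
qed

section \<open>Weighted geometric means\<close>

definition geo_mean :: "'a set \<Rightarrow> ('a \<Rightarrow> real) \<Rightarrow> ('a \<Rightarrow> real) \<Rightarrow> real"
  where "geo_mean V l p = (\<Prod>v\<in>V. p v powr l v)"

lemma geo_mean_nonneg: "0 \<le> geo_mean V l p"
  unfolding geo_mean_def by (intro prod_nonneg) auto

text \<open>Jensen's inequality for the exponential function, at the logarithms of the \<open>p v\<close>; the mean
  vanishes if some \<open>p v\<close> does.\<close>
lemma geo_mean_le_arith_mean:
  assumes V: "finite V" and l: "\<And>v. v \<in> V \<Longrightarrow> 0 \<le> l v" "sum l V = 1"
    and p: "\<And>v. v \<in> V \<Longrightarrow> 0 \<le> p v"
  shows "geo_mean V l p \<le> (\<Sum>v\<in>V. l v * p v)"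
proof (cases "\<forall>v\<in>V. 0 < p v")
  case True
  have ne: "V \<noteq> {}" using l(2) by auto
  have "geo_mean V l p = exp (\<Sum>v\<in>V. l v *\<^sub>R ln (p v))"
    unfolding geo_mean_def exp_sum[OF V] using True by (intro prod.cong) (auto simp: powr_def)
  also have "\<dots> \<le> (\<Sum>v\<in>V. l v * exp (ln (p v)))"
    by (rule convex_on_sum[OF V ne exp_convex]) (use l in auto)
  also have "\<dots> = (\<Sum>v\<in>V. l v * p v)" using True by (intro sum.cong) auto
  finally show ?thesis .
next
  case False
  then obtain v where "v \<in> V" "p v = 0" using p by force
  then have "geo_mean V l p = 0" unfolding geo_mean_def using V by (intro prod_zero) auto
  also have "\<dots> \<le> (\<Sum>v\<in>V. l v * p v)" using l p by (intro sum_nonneg) auto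
  finally show ?thesis .
qed

text \<open>Superadditivity is the Mahler--Minkowski inequality. The mean is multiplicative, so after
  division by the mean of \<open>p + q\<close> the claim is about the means of \<open>p / (p + q)\<close> and \<open>q / (p + q)\<close>.
  These are at most the corresponding arithmetic means, which add up to \<open>1\<close>.\<close>
lemma superlinear_geo_mean:
  assumes V: "finite V" and l: "\<And>v. v \<in> V \<Longrightarrow> 0 \<le> l v" "sum l V = 1"
  shows "superlinear (geo_mean V l)"
  unfolding superlinear_def
proof (intro conjI allI impI)
  fix r :: real and p :: "'a \<Rightarrow> real" assume r: "0 < r"
  have "(\<Prod>v\<in>V. r powr l v) = r" using r l(2) powr_sum[of r l V] by simp
  then show "geo_mean V l (\<lambda>v. r * p v) = r * geo_mean V l p"
    by (simp add: geo_mean_def powr_mult prod.distrib)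
next
  fix p q :: "'a \<Rightarrow> real" assume p: "\<forall>v. 0 \<le> p v" and q: "\<forall>v. 0 \<le> q v"
  let ?s = "\<lambda>v. p v + q v"
  show "geo_mean V l p + geo_mean V l q \<le> geo_mean V l ?s"
  proof (cases "\<forall>v\<in>V. 0 < ?s v")
    case True
    have split: "geo_mean V l x = geo_mean V l ?s * geo_mean V l (\<lambda>v. x v / ?s v)" for x
      unfolding geo_mean_def prod.distrib[symmetric] powr_mult[symmetric]
      using True by (intro prod.cong) force+
    have "geo_mean V l (\<lambda>v. p v / ?s v) + geo_mean V l (\<lambda>v. q v / ?s v)
       \<le> (\<Sum>v\<in>V. l v * (p v / ?s v)) + (\<Sum>v\<in>V. l v * (q v / ?s v))"
      using p q l True by (intro add_mono geo_mean_le_arith_mean V) auto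
    also have "\<dots> = (\<Sum>v\<in>V. l v)"
      unfolding sum.distrib[symmetric] distrib_left[symmetric] add_divide_distrib[symmetric]
      using True by (intro sum.cong) force+
    finally have "geo_mean V l (\<lambda>v. p v / ?s v) + geo_mean V l (\<lambda>v. q v / ?s v) \<le> 1"
      using l by simp
    from mult_left_mono[OF this geo_mean_nonneg[of V l ?s]] show ?thesis
      by (subst split[of p], subst split[of q]) (simp add: distrib_left)
  next
    case False
    then obtain v where "v \<in> V" "\<not> 0 < p v + q v" by blast
    moreover have "0 \<le> p v" "0 \<le> q v" using p q by auto
    ultimately have v: "v \<in> V" "p v = 0" "q v = 0" by linarith+
    then have "geo_mean V l p = 0" "geo_mean V l q = 0"
      unfolding geo_mean_def using V by (auto intro!: prod_zero)
    then show ?thesis by (simp add: geo_mean_nonneg)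
  qed
qed

text \<open>A linear majorant of the mean needs all coefficients to be positive: along the \<open>v\<close>-axis,
  translated to the point \<open>(1, \<dots>, 1)\<close>, the mean grows without bound like \<open>t powr l v\<close>.\<close>
lemma geo_mean_majorant_pos:
  assumes V: "finite V" and l: "\<And>v. v \<in> V \<Longrightarrow> 0 < l v" and g: "0 < g"
    and dom: "\<And>p. \<forall>v. 0 \<le> p v \<Longrightarrow> g * geo_mean V l p \<le> (\<Sum>v\<in>V. c v * p v)"
    and v: "v \<in> V"
  shows "0 < c v"
proof (rule ccontr)
  assume neg: "\<not> 0 < c v"
  define s where "s = (\<Sum>u\<in>V - {v}. c u)"
  (* With t in coordinate v and 1 elsewhere, g times the mean is exactly \<bar>s\<bar> + 1. *)
  define t where "t = ((\<bar>s\<bar> + 1) / g) powr (1 / l v)"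
  define p where "p u = (if u = v then t else 1)" for u
  have "t powr l v = (\<bar>s\<bar> + 1) / g"
    unfolding t_def powr_powr using l[OF v] g by simp
  moreover have "geo_mean V l p = t powr l v"
    unfolding geo_mean_def p_def by (subst prod.remove[OF V v]) auto
  moreover have "(\<Sum>u\<in>V. c u * p u) = c v * t + s"
    unfolding s_def p_def by (subst sum.remove[OF V v]) auto
  moreover have "0 \<le> t" by (simp add: t_def)
  ultimately have "\<bar>s\<bar> + 1 \<le> c v * t + s" using dom[of p] g by (simp add: p_def)
  moreover have "c v * t \<le> 0" using neg \<open>0 \<le> t\<close> by (simp add: mult_nonpos_nonneg)
  ultimately show False by linarith
qed

section \<open>Values of monomials and signomials\<close>

definition abs_val :: "real^'n \<Rightarrow> real^('n::finite) \<Rightarrow> real"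
  where "abs_val x a = real_of_ereal (abs_monom x a)"

lemma abs_monom_eq_infinity_iff:
  "abs_monom x a = \<infinity> \<longleftrightarrow> (\<exists>j. x $ j = 0 \<and> a $ j < 0)"
  unfolding abs_monom_def by auto

lemma abs_val_eq_prod:
  assumes "abs_monom x a \<noteq> \<infinity>"
  shows "abs_val x a = (\<Prod>j\<in>UNIV. if a $ j = 0 then 1 else \<bar>x $ j\<bar> powr (a $ j))"
  using assms unfolding abs_val_def abs_monom_def by (auto split: if_splits)

lemma abs_val_nonneg: "0 \<le> abs_val x a"
  unfolding abs_val_def abs_monom_def by (auto intro!: prod_nonneg)

text \<open>In logarithmic coordinates a monomial is the exponential of a linear form. The zero entries
  of \<open>x\<close>, allowed where the exponent vanishes, do not contribute to the inner product.\<close>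
lemma abs_val_eq_exp:
  assumes "\<And>j. x $ j = 0 \<Longrightarrow> a $ j = 0"
  shows "abs_val x a = exp (a \<bullet> (\<chi> j. ln \<bar>x $ j\<bar>))"
proof -
  have "abs_monom x a \<noteq> \<infinity>"
    using assms unfolding abs_monom_eq_infinity_iff by force
  then show ?thesis
    unfolding abs_val_eq_prod[OF \<open>abs_monom x a \<noteq> \<infinity>\<close>] inner_vec_def
    using assms by (auto simp: exp_sum powr_def intro!: prod.cong)
qed

lemma nat_monom_eq_abs_val:
  assumes "\<And>j. 0 < x $ j"
  shows "nat_monom x b = abs_val x (real_vec b)"
proof -
  have "abs_monom x (real_vec b) \<noteq> \<infinity>"
    unfolding abs_monom_eq_infinity_iff real_vec_def by simp
  moreover have "(x $ j) ^ (b $ j) = (if real (b $ j) = 0 then 1 else \<bar>x $ j\<bar> powr real (b $ j))" for j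
    using assms[of j] by (simp add: powr_realpow)
  ultimately show ?thesis by (simp add: abs_val_eq_prod nat_monom_def real_vec_def cong: if_cong)
qed

lemma nat_monom_le_abs_val: "nat_monom x b \<le> abs_val x (real_vec b)"
proof -
  have "abs_monom x (real_vec b) \<noteq> \<infinity>"
    unfolding abs_monom_eq_infinity_iff real_vec_def by simp
  moreover have "\<bar>x $ j\<bar> ^ (b $ j) = (if real (b $ j) = 0 then 1 else \<bar>x $ j\<bar> powr real (b $ j))" for j
    by (cases "x $ j = 0") (auto simp: powr_realpow)
  ultimately have "abs_val x (real_vec b) = \<bar>nat_monom x b\<bar>"
    by (simp add: abs_val_eq_prod nat_monom_def real_vec_def abs_prod power_abs cong: if_cong)
  then show ?thesis by simp
qed

text \<open>This real number is the value of the signomial away from its poles. In contrast to the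
  extended value it is linear in the signomial, because infinite monomials count as \<open>0\<close>.\<close>
definition val_on :: "(real^'n) set \<Rightarrow> (nat^'n) set \<Rightarrow> ('n::finite) signomial \<Rightarrow> real^'n \<Rightarrow> real"
  where "val_on A B f x = (\<Sum>a\<in>A. fst f a * abs_val x a) + (\<Sum>b\<in>B. snd f b * nat_monom x b)"

lemma sig_val_eq_val_on:
  assumes "finite A" "finite B" "f \<in> signomials A B"
    and "\<And>a. fst f a \<noteq> 0 \<Longrightarrow> abs_monom x a \<noteq> \<infinity>"
  shows "sig_val f x = ereal (val_on A B f x)"
proof -
  have "(\<Sum>a | fst f a \<noteq> 0. fst f a * abs_val x a) = (\<Sum>a\<in>A. fst f a * abs_val x a)"
    using assms unfolding signomials_def by (intro sum.mono_neutral_left) auto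
  moreover have "(\<Sum>b | snd f b \<noteq> 0. snd f b * nat_monom x b) = (\<Sum>b\<in>B. snd f b * nat_monom x b)"
    using assms unfolding signomials_def by (intro sum.mono_neutral_left) auto
  ultimately show ?thesis
    using assms(4) unfolding sig_val_def val_on_def abs_val_def by auto
qed

lemma sig_nonnegI:
  assumes "finite A" "finite B" "f \<in> signomials A B"
    and "\<And>x. (\<And>a. fst f a \<noteq> 0 \<Longrightarrow> abs_monom x a \<noteq> \<infinity>) \<Longrightarrow> 0 \<le> val_on A B f x"
  shows "sig_nonneg f"
  unfolding sig_nonneg_def
proof
  fix x
  show "0 \<le> sig_val f x"
  proof (cases "\<exists>a. fst f a \<noteq> 0 \<and> abs_monom x a = \<infinity>")
    case True
    then show ?thesis by (simp add: sig_val_def)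
  next
    case False
    then have fin: "\<And>a. fst f a \<noteq> 0 \<Longrightarrow> abs_monom x a \<noteq> \<infinity>" by blast
    have "sig_val f x = ereal (val_on A B f x)"
      using assms(1-3) fin by (rule sig_val_eq_val_on)
    moreover have "0 \<le> val_on A B f x" using fin by (rule assms(4))
    ultimately show ?thesis by simp
  qed
qed

lemma sig_nonnegD:
  assumes "finite A" "finite B" "f \<in> signomials A B" "sig_nonneg f" "\<And>j. x $ j \<noteq> 0"
  shows "0 \<le> val_on A B f x"
proof -
  have fin: "abs_monom x a \<noteq> \<infinity>" for a
    unfolding abs_monom_eq_infinity_iff using assms(5) by blast
  have "0 \<le> sig_val f x" using assms(4) by (simp add: sig_nonneg_def)
  then show ?thesis using sig_val_eq_val_on[OF assms(1-3), of x] fin by simp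
qed

section \<open>Conic combinations of non-negative signomials\<close>

definition shift_zeros :: "real^'n \<Rightarrow> real \<Rightarrow> real^('n::finite)"
  where "shift_zeros x e = (\<chi> j. if x $ j = 0 then e else x $ j)"

text \<open>A finite monomial has non-negative exponents at the zero entries of \<open>x\<close>, so it is continuous
  along this path.\<close>
lemma tendsto_abs_val_shift_zeros:
  assumes "abs_monom x a \<noteq> \<infinity>"
  shows "((\<lambda>e. abs_val (shift_zeros x e) a) \<longlongrightarrow> abs_val x a) (at_right 0)"
proof -
  have "((\<lambda>e. if a $ j = 0 then 1 else \<bar>shift_zeros x e $ j\<bar> powr (a $ j))
      \<longlongrightarrow> (if a $ j = 0 then 1 else \<bar>x $ j\<bar> powr (a $ j))) (at_right 0)" for j
  proof (cases "x $ j = 0 \<and> a $ j \<noteq> 0")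
    case True
    then have "0 < a $ j"
      using assms unfolding abs_monom_eq_infinity_iff by (meson linorder_neqE_linordered_idom)
    moreover have "((\<lambda>e::real. \<bar>e\<bar>) \<longlongrightarrow> 0) (at_right 0)"
      by (auto intro!: tendsto_rabs_zero)
    ultimately have "((\<lambda>e::real. \<bar>e\<bar> powr (a $ j)) \<longlongrightarrow> 0) (at_right 0)"
      by (intro tendsto_zero_powrI[where b = "a $ j"]) auto
    then show ?thesis using True by (simp add: shift_zeros_def)
  next
    case False
    then show ?thesis by (auto simp: shift_zeros_def)
  qed
  then have "((\<lambda>e. \<Prod>j\<in>UNIV. if a $ j = 0 then 1 else \<bar>shift_zeros x e $ j\<bar> powr (a $ j))
      \<longlongrightarrow> abs_val x a) (at_right 0)"
    unfolding abs_val_eq_prod[OF assms] by (intro tendsto_prod)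
  moreover have "\<forall>\<^sub>F e in at_right 0.
    (\<Prod>j\<in>UNIV. if a $ j = 0 then 1 else \<bar>shift_zeros x e $ j\<bar> powr (a $ j)) = abs_val (shift_zeros x e) a"
  proof (rule eventually_mono[OF eventually_at_right_less[of 0]])
    fix e :: real assume "0 < e"
    then have "abs_monom (shift_zeros x e) a \<noteq> \<infinity>"
      unfolding abs_monom_eq_infinity_iff shift_zeros_def by auto
    from abs_val_eq_prod[OF this]
    show "(\<Prod>j\<in>UNIV. if a $ j = 0 then 1 else \<bar>shift_zeros x e $ j\<bar> powr (a $ j)) = abs_val (shift_zeros x e) a"
      by simp
  qed
  ultimately show ?thesis by (rule Lim_transform_eventually)
qed

lemma tendsto_nat_monom_shift_zeros:
  "((\<lambda>e. nat_monom (shift_zeros x e) b) \<longlongrightarrow> nat_monom x b) (at_right 0)"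
proof -
  have "((\<lambda>e. shift_zeros x e $ j) \<longlongrightarrow> x $ j) (at_right 0)" for j
    by (cases "x $ j = 0") (auto simp: shift_zeros_def)
  then show ?thesis unfolding nat_monom_def by (intro tendsto_prod tendsto_power)
qed

lemma sig_lincomb_in_signomials:
  assumes "\<And>i. i < k \<Longrightarrow> g i \<in> signomials A B"
  shows "sig_lincomb k l g \<in> signomials A B"
  using assms unfolding sig_lincomb_def signomials_def by auto

lemma val_on_sig_lincomb:
  "val_on A B (sig_lincomb k l g) x = (\<Sum>i<k. l i * val_on A B (g i) x)"
proof -
  have "(\<Sum>a\<in>A. fst (sig_lincomb k l g) a * abs_val x a)
      = (\<Sum>i<k. l i * (\<Sum>a\<in>A. fst (g i) a * abs_val x a))"
    unfolding sig_lincomb_def fst_conv sum_distrib_right sum_distrib_left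
    by (subst sum.swap) (simp add: mult.assoc)
  moreover have "(\<Sum>b\<in>B. snd (sig_lincomb k l g) b * nat_monom x b)
      = (\<Sum>i<k. l i * (\<Sum>b\<in>B. snd (g i) b * nat_monom x b))"
    unfolding sig_lincomb_def snd_conv sum_distrib_right sum_distrib_left
    by (subst sum.swap) (simp add: mult.assoc)
  ultimately show ?thesis unfolding val_on_def by (simp add: distrib_left sum.distrib)
qed

text \<open>At a given point some \<open>g i\<close> may be infinite while the combination is finite, since infinite
  monomials can cancel. Therefore the inequality is not checked at the point itself: it holds at
  nearby points without zero entries, where all monomials are finite, and passes to the limit.\<close>
lemma sig_nonneg_lincomb:
  assumes fin: "finite A" "finite B"
    and l: "\<And>i. i < k \<Longrightarrow> 0 \<le> l i"
    and g: "\<And>i. i < k \<Longrightarrow> g i \<in> signomials A B" "\<And>i. i < k \<Longrightarrow> sig_nonneg (g i)"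
  shows "sig_nonneg (sig_lincomb k l g)"
proof (rule sig_nonnegI[OF fin sig_lincomb_in_signomials[OF g(1)]])
  fix x assume x: "\<And>a. fst (sig_lincomb k l g) a \<noteq> 0 \<Longrightarrow> abs_monom x a \<noteq> \<infinity>"
  let ?f = "sig_lincomb k l g"
  have "((\<lambda>e. fst ?f a * abs_val (shift_zeros x e) a) \<longlongrightarrow> fst ?f a * abs_val x a) (at_right 0)" for a
  proof (cases "fst ?f a = 0")
    case False
    then show ?thesis by (intro tendsto_mult_left tendsto_abs_val_shift_zeros x)
  qed simp
  moreover have "((\<lambda>e. snd ?f b * nat_monom (shift_zeros x e) b)
      \<longlongrightarrow> snd ?f b * nat_monom x b) (at_right 0)" for b
    by (intro tendsto_mult_left tendsto_nat_monom_shift_zeros)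
  ultimately have "((\<lambda>e. val_on A B ?f (shift_zeros x e)) \<longlongrightarrow> val_on A B ?f x) (at_right 0)"
    unfolding val_on_def
    by (intro tendsto_add tendsto_sum)
  moreover have "\<forall>\<^sub>F e in at_right 0. 0 \<le> val_on A B ?f (shift_zeros x e)"
  proof (rule eventually_mono[OF eventually_at_right_less[of 0]])
    fix e :: real assume "0 < e"
    then have "\<And>j. shift_zeros x e $ j \<noteq> 0" by (simp add: shift_zeros_def)
    then show "0 \<le> val_on A B ?f (shift_zeros x e)"
      unfolding val_on_sig_lincomb
      using l g by (intro sum_nonneg mult_nonneg_nonneg sig_nonnegD[OF fin]) auto
  qed
  ultimately show "0 \<le> val_on A B ?f x" by (intro tendsto_lowerbound) auto
qed auto

section \<open>Non-negative circuit functions\<close>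

text \<open>Equality holds where \<open>x\<close> has no zero entries, by linearity of the exponents in logarithmic
  coordinates. A zero entry \<open>j\<close> of \<open>x\<close> forces \<open>v $ j \<ge> 0\<close> for all \<open>v\<close>. So either the monomial with
  exponent \<open>w\<close> vanishes, or all exponents \<open>v\<close> vanish in the entry \<open>j\<close> and it can be ignored.\<close>
lemma abs_val_convex_combination:
  fixes V :: "(real^'n) set"
  assumes V: "finite V" and l: "\<And>v. v \<in> V \<Longrightarrow> 0 < l v"
    and w: "w = (\<Sum>v\<in>V. l v *\<^sub>R v)"
    and x: "\<And>v. v \<in> V \<Longrightarrow> abs_monom x v \<noteq> \<infinity>"
  shows "abs_monom x w \<noteq> \<infinity>" "abs_val x w \<le> geo_mean V l (abs_val x)"
proof -
  have wj: "w $ j = (\<Sum>v\<in>V. l v * v $ j)" for j by (simp add: w)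
  have pos: "0 \<le> l v * v $ j" if "x $ j = 0" "v \<in> V" for v j
    using x[OF that(2)] l[OF that(2)] that(1) unfolding abs_monom_eq_infinity_iff
    by (simp add: not_less)
  then have "0 \<le> w $ j" if "x $ j = 0" for j
    unfolding wj using that by (intro sum_nonneg)
  then show fin: "abs_monom x w \<noteq> \<infinity>"
    unfolding abs_monom_eq_infinity_iff by (simp add: not_less)
  show "abs_val x w \<le> geo_mean V l (abs_val x)"
  proof (cases "\<exists>j. x $ j = 0 \<and> w $ j \<noteq> 0")
    case True
    then have "abs_val x w = 0" unfolding abs_val_eq_prod[OF fin] by (auto intro!: prod_zero)
    then show ?thesis by (simp add: geo_mean_nonneg)
  next
    case False
    let ?y = "\<chi> j. ln \<bar>x $ j\<bar>"
    have zero: "v $ j = 0" if "x $ j = 0" "v \<in> V" for v j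
    proof -
      have "(\<Sum>v\<in>V. l v * v $ j) = 0" using False that(1) wj by metis
      then have "l v * v $ j = 0"
        using sum_nonneg_eq_0_iff[OF V, of "\<lambda>v. l v * v $ j"] pos that by blast
      then show ?thesis using l[OF that(2)] by simp
    qed
    have "abs_val x w = exp (\<Sum>v\<in>V. l v * (v \<bullet> ?y))"
      using False by (subst abs_val_eq_exp) (auto simp: w inner_sum_left)
    also have "\<dots> = geo_mean V l (abs_val x)"
      unfolding geo_mean_def exp_sum[OF V]
    proof (rule prod.cong)
      fix v assume "v \<in> V"
      then have "abs_val x v = exp (v \<bullet> ?y)" using zero by (intro abs_val_eq_exp)
      then show "exp (l v * (v \<bullet> ?y)) = abs_val x v powr l v" by (simp add: powr_def)
    qed simp
    finally show ?thesis by simp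
  qed
qed

lemma convex_combination_is_circuit:
  assumes "finite V" "\<not> affine_dependent V" "\<And>v. v \<in> V \<Longrightarrow> 0 < l v" "sum l V = 1"
    and "w = (\<Sum>v\<in>V. l v *\<^sub>R v)"
  shows "is_circuit V w"
  unfolding is_circuit_def rel_interior_convex_hull_explicit[OF assms(2)] using assms by auto

text \<open>A pole of an outer monomial makes the circuit function infinite, because its coefficient is
  positive and, as \<open>w \<notin> V\<close>, is not changed by the inner term. Elsewhere the inner monomial is at most the geometric mean of the outer monomials, which
  turns a majorant of the mean into non-negativity.\<close>
lemma even_circuit_nonneg:
  fixes V :: "(real^'n) set"
  assumes V: "finite V" "\<not> affine_dependent V"
    and l: "\<And>v. v \<in> V \<Longrightarrow> 0 < l v" "sum l V = 1" and w: "w = (\<Sum>v\<in>V. l v *\<^sub>R v)" "w \<notin> V"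
    and g: "0 < g"
    and dom: "\<And>p. \<forall>v. 0 \<le> p v \<Longrightarrow> g * geo_mean V l p \<le> (\<Sum>v\<in>V. c v * p v)"
  defines "F \<equiv> (\<lambda>a. (if a \<in> V then c a else 0) + (if a = w then - g else 0), \<lambda>_. 0)"
  shows "sig_nonneg F" "AG_function F" "circuit_function V w F"
proof -
  have c: "0 < c v" if "v \<in> V" for v by (rule geo_mean_majorant_pos[OF V(1) l(1) g dom that])
  show "sig_nonneg F"
  proof (rule sig_nonnegI[of "insert w V" "{}"])
    fix x assume fin: "\<And>a. fst F a \<noteq> 0 \<Longrightarrow> abs_monom x a \<noteq> \<infinity>"
    have x: "abs_monom x v \<noteq> \<infinity>" if "v \<in> V" for v
      using that w(2) c[OF that] by (intro fin) (auto simp: F_def)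
    have "g * abs_val x w \<le> g * geo_mean V l (abs_val x)"
      using g abs_val_convex_combination(2)[OF V(1) l(1) w(1) x] by simp
    also have "\<dots> \<le> (\<Sum>v\<in>V. c v * abs_val x v)" by (intro dom) (simp add: abs_val_nonneg)
    also have "\<dots> = (\<Sum>v\<in>V. fst F v * abs_val x v)"
      using w(2) by (intro sum.cong) (auto simp: F_def)
    finally show "0 \<le> val_on (insert w V) {} F x"
      using V w(2) unfolding val_on_def by (simp add: F_def)
  qed (use V in \<open>auto simp: signomials_def F_def\<close>)
  show AG: "AG_function F"
  proof -
    have "a = w" if "fst F a < 0" for a
      using that c[of a] by (cases "a = w"; cases "a \<in> V") (auto simp: F_def)
    moreover have "snd F b = 0" for b by (simp add: F_def)
    ultimately show ?thesis unfolding AG_function_def even_AG_def by blast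
  qed
  show "circuit_function V w F"
    unfolding circuit_function_def even_circuit_function_def
    using convex_combination_is_circuit[OF V l w(1)] AG c F_def by blast
qed

text \<open>The same argument, after the estimate of \<open>x\<^sup>b\<close> by its absolute value. Here the exponent \<open>b\<close>
  may itself belong to \<open>V\<close>, because the odd and the even monomial of a common exponent are separate
  terms.\<close>
lemma odd_circuit_nonneg:
  fixes V :: "(real^'n) set"
  assumes V: "finite V" "\<not> affine_dependent V"
    and l: "\<And>v. v \<in> V \<Longrightarrow> 0 < l v" "sum l V = 1" and b: "real_vec b = (\<Sum>v\<in>V. l v *\<^sub>R v)"
    and odd: "\<exists>j. odd (b $ j)" and g: "0 < g"
    and dom: "\<And>p. \<forall>v. 0 \<le> p v \<Longrightarrow> g * geo_mean V l p \<le> (\<Sum>v\<in>V. c v * p v)"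
  defines "F \<equiv> (\<lambda>a. if a \<in> V then c a else 0, \<lambda>b'. if b' = b then - g else 0)"
  shows "sig_nonneg F" "AG_function F" "circuit_function V (real_vec b) F"
proof -
  have c: "0 < c v" if "v \<in> V" for v by (rule geo_mean_majorant_pos[OF V(1) l(1) g dom that])
  show "sig_nonneg F"
  proof (rule sig_nonnegI[of V "{b}"])
    fix x assume fin: "\<And>a. fst F a \<noteq> 0 \<Longrightarrow> abs_monom x a \<noteq> \<infinity>"
    have x: "abs_monom x v \<noteq> \<infinity>" if "v \<in> V" for v
      using that c[OF that] by (intro fin) (auto simp: F_def)
    have "g * nat_monom x b \<le> g * abs_val x (real_vec b)"
      using g nat_monom_le_abs_val by simp
    also have "\<dots> \<le> g * geo_mean V l (abs_val x)"
      using g abs_val_convex_combination(2)[OF V(1) l(1) b x] by simp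
    also have "\<dots> \<le> (\<Sum>v\<in>V. c v * abs_val x v)" by (intro dom) (simp add: abs_val_nonneg)
    finally show "0 \<le> val_on V {b} F x" unfolding val_on_def by (simp add: F_def)
  qed (use V in \<open>auto simp: signomials_def F_def\<close>)
  show AG: "AG_function F"
  proof -
    have "0 \<le> fst F a" for a using c[of a] by (auto simp: F_def)
    moreover have "b' = b" if "snd F b' \<noteq> 0" for b'
      using that by (simp add: F_def split: if_splits)
    ultimately show ?thesis unfolding AG_function_def odd_AG_def by blast
  qed
  show "circuit_function V (real_vec b) F"
    unfolding circuit_function_def odd_circuit_function_def
    using convex_combination_is_circuit[OF V l b] AG c F_def odd by blast
qed

text \<open>The outer coefficient of a circuit function is strictly positive, so the coefficient \<open>r\<close>,
  which may be \<open>0\<close>, is written as \<open>(r + 1) - 1\<close> with inner exponent \<open>v\<close>.\<close>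
lemma nonneg_abs_monom_circuit:
  fixes v :: "real^'n"
  assumes r: "0 \<le> r"
  defines "F \<equiv> (\<lambda>a. if a = v then r else 0, \<lambda>_. 0)"
  shows "sig_nonneg F" "AG_function F" "circuit_function {v} v F"
proof -
  show "sig_nonneg F"
    by (rule sig_nonnegI[of "{v}" "{}"])
      (use r in \<open>auto simp: signomials_def F_def val_on_def abs_val_nonneg\<close>)
  show AG: "AG_function F"
    using r unfolding AG_function_def even_AG_def F_def by auto
  have "even_circuit_function {v} v F"
    unfolding even_circuit_function_def
  proof (intro conjI exI)
    show "is_circuit {v} v" unfolding is_circuit_def by simp
    show "AG_function F" by (rule AG)
    show "\<forall>a\<in>{v}. 0 < r + 1" using r by simp
    show "F = (\<lambda>a. (if a \<in> {v} then r + 1 else 0) + (if a = v then -1 else 0), \<lambda>_. 0)"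
      unfolding F_def by auto
  qed
  then show "circuit_function {v} v F" by (simp add: circuit_function_def)
qed

section \<open>Decomposition of signomials supported on a simplex\<close>

lemma affine_independent_interpolation:
  fixes C :: "'a::euclidean_space set" and z :: "'a \<Rightarrow> real"
  assumes "\<not> affine_dependent C"
  shows "\<exists>y t. \<forall>v\<in>C. v \<bullet> y + t = z v"
proof (cases "C = {}")
  case False
  then obtain v0 where v0: "v0 \<in> C" by blast
  have "independent ((\<lambda>x. - v0 + x) ` (C - {v0}))"
    using assms affine_dependent_iff_dependent2[OF v0] by simp
  from linear_independent_extend[OF this, of "\<lambda>d. z (v0 + d) - z v0"]
  obtain h :: "'a \<Rightarrow> real" where h: "linear h"
    "\<And>v. v \<in> C - {v0} \<Longrightarrow> h (- v0 + v) = z v - z v0" by auto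
  define y where "y = adjoint h 1"
  have "d \<bullet> y = h d" for d
    unfolding y_def using adjoint_works[OF h(1), of d 1] by (simp add: inner_commute)
  then have "v \<bullet> y + (z v0 - v0 \<bullet> y) = z v" if "v \<in> C" for v
    using h(2)[of v] that linear_add[OF h(1), of "- v0" v] linear_neg[OF h(1), of v0]
    by (cases "v = v0") auto
  then show ?thesis by blast
qed simp

lemma finite_family_sig_lincomb:
  assumes "finite J" "\<And>j. j \<in> J \<Longrightarrow> Q (F j)"
  shows "\<exists>k g. (\<forall>i<k. Q (g i)) \<and>
    sig_lincomb k (\<lambda>_. 1) g = (\<lambda>a. \<Sum>j\<in>J. fst (F j) a, \<lambda>b. \<Sum>j\<in>J. snd (F j) b)"
proof -
  obtain e :: "nat \<Rightarrow> 'a" where e: "bij_betw e {..<card J} J"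
    using ex_bij_betw_nat_finite[OF assms(1)] by (auto simp: atLeast0LessThan)
  show ?thesis
  proof (intro exI conjI)
    show "\<forall>i<card J. Q ((F \<circ> e) i)" using assms(2) e by (auto simp: bij_betw_def)
    show "sig_lincomb (card J) (\<lambda>_. 1) (F \<circ> e)
        = (\<lambda>a. \<Sum>j\<in>J. fst (F j) a, \<lambda>b. \<Sum>j\<in>J. snd (F j) b)"
      unfolding sig_lincomb_def
      using sum.reindex_bij_betw[OF e, of "\<lambda>j. fst (F j) a" for a]
        sum.reindex_bij_betw[OF e, of "\<lambda>j. snd (F j) b" for b] by simp
  qed
qed

text \<open>Non-negativity of \<open>f\<close> on the positive orthant in coordinates adapted to the simplex. By affine
  independence, the point \<open>x\<close> can be chosen such that the vertex monomials are proportional to any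
  given positive numbers \<open>q v\<close>. The factor \<open>exp (- t)\<close> of proportionality also appears in the other
  monomials, because barycentric coordinates add up to \<open>1\<close>; thus it cancels, and the other monomials
  become geometric means. Points \<open>p\<close> with zero entries follow by adding a positive \<open>e\<close> to all entries:
  the left-hand side is monotone, so no continuity of it is needed.\<close>
lemma sig_nonneg_imp_geo_mean_le:
  fixes C :: "(real^'n) set"
  assumes C: "finite C" "\<not> affine_dependent C"
    and AB: "finite A" "finite B" "C \<subseteq> A"
    and f: "f \<in> signomials A B" "sig_nonneg f"
    and la: "\<And>a. a \<in> A - C \<Longrightarrow> sum (la a) C = 1 \<and> (\<forall>v\<in>C. 0 \<le> la a v) \<and> a = (\<Sum>v\<in>C. la a v *\<^sub>R v)"
    and lb: "\<And>b. b \<in> B \<Longrightarrow> sum (lb b) C = 1 \<and> (\<forall>v\<in>C. 0 \<le> lb b v) \<and> real_vec b = (\<Sum>v\<in>C. lb b v *\<^sub>R v)"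
    and neg: "\<And>a. a \<in> A - C \<Longrightarrow> fst f a \<le> 0" "\<And>b. b \<in> B \<Longrightarrow> snd f b \<le> 0"
    and p: "\<forall>v. 0 \<le> p v"
  shows "(\<Sum>a\<in>A - C. - fst f a * geo_mean {v\<in>C. 0 < la a v} (la a) p) +
    (\<Sum>b\<in>B. - snd f b * geo_mean {v\<in>C. 0 < lb b v} (lb b) p) \<le> (\<Sum>v\<in>C. fst f v * p v)"
    (is "?L p \<le> ?R p")
proof -
  have pos: "?L q \<le> ?R q" if q: "\<forall>v. 0 < q v" for q
  proof -
    obtain y t where yt: "\<And>v. v \<in> C \<Longrightarrow> v \<bullet> y + t = ln (q v)"
      using affine_independent_interpolation[OF C(2), of "\<lambda>v. ln (q v)"] by auto
    define x where "x = (\<chi> j. exp (y $ j))"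
    have xpos: "0 < x $ j" for j by (simp add: x_def)
    have val: "abs_val x a = exp (a \<bullet> y)" for a
    proof -
      have "(\<chi> j. ln \<bar>x $ j\<bar>) = y" by (simp add: x_def vec_eq_iff)
      then show ?thesis using abs_val_eq_exp[of x a] xpos by (metis less_irrefl)
    qed
    have vertex: "abs_val x v = exp (- t) * q v" if "v \<in> C" for v
    proof -
      have "v \<bullet> y = - t + ln (q v)" using yt[OF that] by simp
      then have "abs_val x v = exp (- t) * exp (ln (q v))" by (simp only: val exp_add)
      then show ?thesis using q by simp
    qed
    have inner: "abs_val x w = exp (- t) * geo_mean {v\<in>C. 0 < l v} l q"
      if l: "sum l C = 1" "\<forall>v\<in>C. 0 \<le> l v" "w = (\<Sum>v\<in>C. l v *\<^sub>R v)" for l w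
    proof -
      have "w \<bullet> y = (\<Sum>v\<in>C. l v * (v \<bullet> y))" by (simp add: l(3) inner_sum_left)
      also have "\<dots> = (\<Sum>v\<in>C. l v * ln (q v)) - (\<Sum>v\<in>C. l v * t)"
        unfolding sum_subtractf[symmetric] right_diff_distrib[symmetric]
        by (intro sum.cong) (simp_all flip: yt)
      also have "(\<Sum>v\<in>C. l v * t) = t" by (simp add: l(1) flip: sum_distrib_right)
      also have "(\<Sum>v\<in>C. l v * ln (q v)) = (\<Sum>v | v \<in> C \<and> 0 < l v. l v * ln (q v))"
        using C(1) l(2) by (intro sum.mono_neutral_right) force+
      finally have "w \<bullet> y = - t + (\<Sum>v | v \<in> C \<and> 0 < l v. l v * ln (q v))" by simp
      moreover have "exp (\<Sum>v | v \<in> C \<and> 0 < l v. l v * ln (q v)) = geo_mean {v\<in>C. 0 < l v} l q"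
        unfolding geo_mean_def using C(1) q
        by (subst exp_sum) (auto simp: powr_def less_imp_neq[symmetric] intro!: prod.cong)
      ultimately show ?thesis by (simp only: val exp_add)
    qed
    have "0 \<le> val_on A B f x"
      using sig_nonnegD[OF AB(1,2) f] xpos by (metis less_irrefl)
    also have "val_on A B f x = (\<Sum>a\<in>C. fst f a * abs_val x a) + (\<Sum>a\<in>A - C. fst f a * abs_val x a)
        + (\<Sum>b\<in>B. snd f b * abs_val x (real_vec b))"
      unfolding val_on_def sum.subset_diff[OF AB(3,1)] by (simp add: nat_monom_eq_abs_val[OF xpos])
    also have "(\<Sum>a\<in>C. fst f a * abs_val x a) = exp (- t) * ?R q"
      by (simp add: vertex sum_distrib_left algebra_simps)
    also have "(\<Sum>a\<in>A - C. fst f a * abs_val x a)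
        = exp (- t) * (\<Sum>a\<in>A - C. fst f a * geo_mean {v\<in>C. 0 < la a v} (la a) q)"
      unfolding sum_distrib_left
    proof (rule sum.cong)
      fix a assume "a \<in> A - C"
      then have "abs_val x a = exp (- t) * geo_mean {v\<in>C. 0 < la a v} (la a) q"
        using la by (intro inner) auto
      then show "fst f a * abs_val x a = exp (- t) * (fst f a * geo_mean {v\<in>C. 0 < la a v} (la a) q)"
        by simp
    qed simp
    also have "(\<Sum>b\<in>B. snd f b * abs_val x (real_vec b))
        = exp (- t) * (\<Sum>b\<in>B. snd f b * geo_mean {v\<in>C. 0 < lb b v} (lb b) q)"
      unfolding sum_distrib_left
    proof (rule sum.cong)
      fix b assume "b \<in> B"
      then have "abs_val x (real_vec b) = exp (- t) * geo_mean {v\<in>C. 0 < lb b v} (lb b) q"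
        using lb by (intro inner) auto
      then show "snd f b * abs_val x (real_vec b) = exp (- t) * (snd f b * geo_mean {v\<in>C. 0 < lb b v} (lb b) q)"
        by simp
    qed simp
    finally have "0 \<le> exp (- t) * (?R q - ?L q)"
      by (simp add: algebra_simps sum_negf)
    then show ?thesis by (simp add: zero_le_mult_iff)
  qed
  have mono: "geo_mean V l p \<le> geo_mean V l (\<lambda>v. p v + e)"
    if "0 < e" "\<forall>v\<in>V. 0 < l v" for V l e
    unfolding geo_mean_def using p that
    by (intro prod_mono conjI powr_mono2) (auto intro: less_imp_le)
  have perturbed: "?L p \<le> ?R p + (\<Sum>v\<in>C. fst f v) * e" if e: "0 < e" for e
  proof -
    have "?L p \<le> ?L (\<lambda>v. p v + e)"
      using neg e by (intro add_mono sum_mono mult_left_mono mono) auto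
    also have "\<dots> \<le> ?R (\<lambda>v. p v + e)" using p e by (intro pos) (simp add: add_nonneg_pos)
    also have "\<dots> = ?R p + (\<Sum>v\<in>C. fst f v) * e"
      by (simp add: distrib_left sum.distrib sum_distrib_right)
    finally show ?thesis .
  qed
  have "((\<lambda>e. ?R p + (\<Sum>v\<in>C. fst f v) * e) \<longlongrightarrow> ?R p + (\<Sum>v\<in>C. fst f v) * 0) (at_right 0)"
    by (intro tendsto_intros)
  then show ?thesis
    using tendsto_lowerbound[OF _ eventually_mono[OF eventually_at_right_less[of 0] perturbed]]
    by force
qed

text \<open>Each negative term \<open>i\<close> receives a share \<open>m i\<close> of the vertex coefficients that dominates its
  geometric mean. The share on the vertices \<open>V i\<close> with positive barycentric coordinate gives a
  non-negative circuit function \<open>F i\<close>. What remains of the coefficient at a vertex \<open>v\<close>, including the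
  shares outside \<open>V i\<close>, is a non-negative multiple \<open>M v\<close> of the vertex monomial. Terms with
  coefficient \<open>0\<close> are discarded first, since their share could vanish, whereas the outer coefficients
  of a circuit function are positive.\<close>
lemma circuit_decomposition_over_simplex:
  fixes C :: "(real^'n) set"
  assumes C: "\<not> affine_dependent C"
    and AB: "finite A" "finite B" "C \<subseteq> A" "A \<subseteq> convex hull C" "real_vec ` B \<subseteq> convex hull C"
    and odd: "\<forall>b\<in>B. \<exists>j. odd (b $ j)"
    and f: "f \<in> signomials A B" "sig_nonneg f"
    and neg: "\<And>a. a \<in> A - C \<Longrightarrow> fst f a \<le> 0" "\<And>b. b \<in> B \<Longrightarrow> snd f b \<le> 0"
  shows "\<exists>k g. (\<forall>i<k. g i \<in> signomials A B \<and> AG_function (g i) \<and> sig_nonneg (g i) \<and>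
      (\<exists>V b. V \<subseteq> C \<and> circuit_function V b (g i))) \<and> f = sig_lincomb k (\<lambda>_. 1) g"
proof -
  have finC: "finite C" using AB finite_subset by blast
  let ?e = "case_sum (\<lambda>a. a) real_vec"
  (* A disjoint sum, because one exponent may occur both in an even and in an odd term. *)
  define J where "J = (A - C) <+> B"
  have coordinates: "\<exists>u. sum u C = 1 \<and> (\<forall>v\<in>C. 0 \<le> u v) \<and> ?e i = (\<Sum>v\<in>C. u v *\<^sub>R v)"
    if "i \<in> J" for i
  proof -
    have "?e i \<in> convex hull C" using that AB(4,5) by (auto simp: J_def)
    then obtain u where "\<forall>v\<in>C. 0 \<le> u v" "sum u C = 1" "(\<Sum>v\<in>C. u v *\<^sub>R v) = ?e i"
      unfolding convex_hull_finite[OF finC] by auto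
    then show ?thesis by (intro exI[of _ u]) simp
  qed
  define l where "l i = (SOME u. sum u C = 1 \<and> (\<forall>v\<in>C. 0 \<le> u v) \<and> ?e i = (\<Sum>v\<in>C. u v *\<^sub>R v))"
    for i
  have l: "sum (l i) C = 1 \<and> (\<forall>v\<in>C. 0 \<le> l i v) \<and> ?e i = (\<Sum>v\<in>C. l i v *\<^sub>R v)"
    if "i \<in> J" for i
    unfolding l_def by (rule someI_ex[OF coordinates[OF that]])
  define g where "g = case_sum (\<lambda>a. - fst f a) (\<lambda>b. - snd f b)"
  define V where "V i = {v \<in> C. 0 < l i v}" for i
  define I where "I = {i \<in> J. 0 < g i}"
  have finI: "finite I" "finite J" and VC: "V i \<subseteq> C" and finV: "finite (V i)" for i
    using AB finC by (auto simp: I_def J_def V_def)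
  have gJ: "0 \<le> g i" if "i \<in> J" for i using that neg by (auto simp: J_def g_def)
  have VI: "sum (l i) (V i) = 1" "?e i = (\<Sum>v\<in>V i. l i v *\<^sub>R v)" if "i \<in> J" for i
  proof -
    have zero: "l i v = 0" if "v \<in> C - V i" for v
      using that l[OF \<open>i \<in> J\<close>] by (force simp: V_def)
    have "sum (l i) (V i) = sum (l i) C" "(\<Sum>v\<in>V i. l i v *\<^sub>R v) = (\<Sum>v\<in>C. l i v *\<^sub>R v)"
      by (rule sum.mono_neutral_left[OF finC VC]; simp add: zero)+
    then show "sum (l i) (V i) = 1" "?e i = (\<Sum>v\<in>V i. l i v *\<^sub>R v)" using l[OF that] by auto
  qed
  have "\<exists>m. (\<forall>i\<in>I. \<forall>p. (\<forall>v. 0 \<le> p v) \<longrightarrow>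
        g i * geo_mean (V i) (l i) p \<le> (\<Sum>v\<in>C. m i v * p v)) \<and>
      (\<forall>v\<in>C. (\<Sum>i\<in>I. m i v) \<le> fst f v)"
  proof (rule distribute_linear_majorant[OF finC finI(1)])
    fix i assume "i \<in> I"
    then show "superlinear (\<lambda>p. g i * geo_mean (V i) (l i) p)"
      using VI[of i] finV
      by (intro superlinear_mult superlinear_geo_mean) (auto simp: I_def V_def)
  next
    fix i and p q :: "real^'n \<Rightarrow> real" assume "\<forall>v\<in>C. p v = q v"
    then show "g i * geo_mean (V i) (l i) p = g i * geo_mean (V i) (l i) q"
      using VC[of i] by (auto simp: geo_mean_def intro!: prod.cong)
  next
    fix p :: "real^'n \<Rightarrow> real" assume p: "\<forall>v. 0 \<le> p v"
    have "(\<Sum>i\<in>I. g i * geo_mean (V i) (l i) p) = (\<Sum>i\<in>J. g i * geo_mean (V i) (l i) p)"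
      using finI gJ by (intro sum.mono_neutral_left) (auto simp: I_def less_le)
    also have "\<dots> = (\<Sum>a\<in>A - C. - fst f a * geo_mean (V (Inl a)) (l (Inl a)) p)
        + (\<Sum>b\<in>B. - snd f b * geo_mean (V (Inr b)) (l (Inr b)) p)"
      unfolding J_def using AB by (subst sum.Plus) (auto simp: g_def)
    also have "\<dots> \<le> (\<Sum>v\<in>C. fst f v * p v)"
      unfolding V_def
    proof (rule sig_nonneg_imp_geo_mean_le[OF finC C AB(1-3) f])
      fix a assume "a \<in> A - C"
      then show "sum (l (Inl a)) C = 1 \<and> (\<forall>v\<in>C. 0 \<le> l (Inl a) v) \<and> a = (\<Sum>v\<in>C. l (Inl a) v *\<^sub>R v)"
        using l[of "Inl a", unfolded J_def, OF InlI] by simp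
    next
      fix b assume "b \<in> B"
      then show "sum (l (Inr b)) C = 1 \<and> (\<forall>v\<in>C. 0 \<le> l (Inr b) v) \<and> real_vec b = (\<Sum>v\<in>C. l (Inr b) v *\<^sub>R v)"
        using l[of "Inr b", unfolded J_def, OF InrI] by simp
    qed (use neg p in auto)
    finally show "(\<Sum>i\<in>I. g i * geo_mean (V i) (l i) p) \<le> (\<Sum>v\<in>C. fst f v * p v)" .
  qed
  then obtain m where m: "\<And>i p. i \<in> I \<Longrightarrow> \<forall>v. 0 \<le> p v \<Longrightarrow>
        g i * geo_mean (V i) (l i) p \<le> (\<Sum>v\<in>C. m i v * p v)"
      "\<And>v. v \<in> C \<Longrightarrow> (\<Sum>i\<in>I. m i v) \<le> fst f v" by blast
  have m_nonneg: "0 \<le> m i v" if "i \<in> I" "v \<in> C" for i v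
  proof -
    have "0 \<le> g i * geo_mean (V i) (l i) (\<lambda>u. if u = v then 1 else 0)"
      using that by (simp add: geo_mean_nonneg I_def)
    also have "\<dots> \<le> (\<Sum>u\<in>C. m i u * (if u = v then 1 else 0))" using that by (intro m(1)) auto
    also have "\<dots> = m i v" using that finC by (simp add: if_distrib cong: if_cong)
    finally show ?thesis .
  qed
  (* The mean ignores the entries of p outside V i, so these may be set to 0. *)
  have dom: "g i * geo_mean (V i) (l i) p \<le> (\<Sum>v\<in>V i. m i v * p v)"
    if "i \<in> I" "\<forall>v. 0 \<le> p v" for i p
  proof -
    have "g i * geo_mean (V i) (l i) p = g i * geo_mean (V i) (l i) (\<lambda>v. if v \<in> V i then p v else 0)"
      by (simp add: geo_mean_def)
    also have "\<dots> \<le> (\<Sum>v\<in>C. m i v * (if v \<in> V i then p v else 0))"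
      using that by (intro m(1)) auto
    also have "\<dots> = (\<Sum>v\<in>V i. m i v * p v)"
      using finC VC[of i] by (intro sum.mono_neutral_cong_right) auto
    finally show ?thesis .
  qed
  define F where "F i = (\<lambda>a. (if a \<in> V i then m i a else 0) + (if i = Inl a then - g i else 0),
      \<lambda>b. if i = Inr b then - g i else 0)" for i
  define r where "r v = fst f v - (\<Sum>i\<in>I. if v \<in> V i then m i v else 0)" for v
  define M where "M v = (\<lambda>a. if a = v then r v else 0, \<lambda>_ :: nat^'n. 0 :: real)" for v
  define Q where "Q h \<longleftrightarrow> h \<in> signomials A B \<and> AG_function h \<and> sig_nonneg h \<and>
      (\<exists>V b. V \<subseteq> C \<and> circuit_function V b h)" for h :: "'n signomial"
  have indep: "\<not> affine_dependent (V i)" for i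
    using C VC affine_dependent_subset by blast
  have QF: "Q (F i)" if i: "i \<in> I" for i
  proof -
    have iJ: "i \<in> J" and gi: "0 < g i" using i by (auto simp: I_def)
    have sig: "F i \<in> signomials A B"
      using iJ VC[of i] AB(3) by (auto simp: F_def signomials_def J_def)
    have lpos: "\<And>v. v \<in> V i \<Longrightarrow> 0 < l i v" by (simp add: V_def)
    show ?thesis
    proof (cases i)
      case (Inl a)
      have eq: "F i = (\<lambda>x. (if x \<in> V i then m i x else 0) + (if x = a then - g i else 0), \<lambda>_. 0)"
        using Inl by (auto simp: F_def)
      have "a = (\<Sum>v\<in>V i. l i v *\<^sub>R v)" "a \<notin> V i"
        using VI(2)[OF iJ] iJ VC[of i] Inl by (auto simp: J_def)
      from even_circuit_nonneg[OF finV indep lpos VI(1)[OF iJ] this gi dom[OF i]]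
      show ?thesis unfolding Q_def using sig VC[of i] eq by auto
    next
      case (Inr b)
      have eq: "F i = (\<lambda>x. if x \<in> V i then m i x else 0, \<lambda>x. if x = b then - g i else 0)"
        using Inr by (auto simp: F_def)
      have "real_vec b = (\<Sum>v\<in>V i. l i v *\<^sub>R v)" "\<exists>j. odd (b $ j)"
        using VI(2)[OF iJ] iJ odd Inr by (auto simp: J_def)
      from odd_circuit_nonneg[OF finV indep lpos VI(1)[OF iJ] this gi dom[OF i]]
      show ?thesis unfolding Q_def using sig VC[of i] eq by auto
    qed
  qed
  have QM: "Q (M v)" if "v \<in> C" for v
  proof -
    have "(\<Sum>i\<in>I. if v \<in> V i then m i v else 0) \<le> (\<Sum>i\<in>I. m i v)"
      using m_nonneg that by (intro sum_mono) auto
    then have "0 \<le> r v" using m(2)[OF that] by (simp add: r_def)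
    from nonneg_abs_monom_circuit[OF this, of v] show ?thesis
      using that AB(3) unfolding Q_def M_def by (auto simp: signomials_def)
  qed
  have "\<exists>k h. (\<forall>i<k. Q (h i)) \<and> sig_lincomb k (\<lambda>_. 1) h =
      (\<lambda>a. \<Sum>j\<in>I <+> C. fst (case_sum F M j) a, \<lambda>b. \<Sum>j\<in>I <+> C. snd (case_sum F M j) b)"
    using finI finC QF QM by (intro finite_family_sig_lincomb) auto
  moreover have "(\<Sum>j\<in>I <+> C. fst (case_sum F M j) a) = fst f a" for a
  proof -
    have "(\<Sum>j\<in>I <+> C. fst (case_sum F M j) a) = (\<Sum>i\<in>I. fst (F i) a) + (\<Sum>v\<in>C. fst (M v) a)"
      using finI finC by (simp add: sum.Plus)
    also have "(\<Sum>i\<in>I. fst (F i) a) = (\<Sum>i\<in>I. if a \<in> V i then m i a else 0)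
        + (if Inl a \<in> I then - g (Inl a) else 0)"
      unfolding F_def fst_conv sum.distrib
      using sum.delta[OF finI(1), of "Inl a" "\<lambda>i. - g i"] by (simp cong: if_cong)
    also have "(\<Sum>v\<in>C. fst (M v) a) = (if a \<in> C then r a else 0)"
      unfolding M_def fst_conv using sum.delta'[OF finC, of a r] by simp
    also have "(\<Sum>i\<in>I. if a \<in> V i then m i a else 0) + (if Inl a \<in> I then - g (Inl a) else 0)
        + (if a \<in> C then r a else 0) = fst f a"
    proof (cases "a \<in> C")
      case True
      then show ?thesis by (auto simp: r_def I_def J_def)
    next
      case False
      then have "(\<Sum>i\<in>I. if a \<in> V i then m i a else 0) = 0" using VC by (intro sum.neutral) auto
      moreover have "fst f a = 0" if "Inl a \<notin> I"
      proof (cases "a \<in> A")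
        case True
        then show ?thesis using that False neg(1)[of a] by (auto simp: I_def J_def g_def)
      qed (use f(1) in \<open>auto simp: signomials_def\<close>)
      ultimately show ?thesis using False by (auto simp: g_def)
    qed
    finally show ?thesis .
  qed
  moreover have "(\<Sum>j\<in>I <+> C. snd (case_sum F M j) b) = snd f b" for b
  proof -
    have "(\<Sum>j\<in>I <+> C. snd (case_sum F M j) b) = (\<Sum>i\<in>I. snd (F i) b)"
      using finI finC by (simp add: sum.Plus M_def)
    also have "\<dots> = (if Inr b \<in> I then - g (Inr b) else 0)"
      unfolding F_def snd_conv
      using sum.delta[OF finI(1), of "Inr b" "\<lambda>i. - g i"] by (simp cong: if_cong)
    also have "\<dots> = snd f b"
    proof (cases "b \<in> B")
      case True
      then show ?thesis using neg(2)[of b] by (auto simp: I_def J_def g_def)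
    qed (use f(1) in \<open>auto simp: signomials_def g_def\<close>)
    finally show ?thesis .
  qed
  ultimately have "\<exists>k h. (\<forall>i<k. Q (h i)) \<and> sig_lincomb k (\<lambda>_. 1) h = f" by simp
  then show ?thesis unfolding Q_def by (metis (no_types, lifting))
qed

theorem proposition4p12:
  fixes A :: "(real^'n) set" and B :: "(nat^'n) set" and f :: "('n::finite) signomial"
  assumes "finite A" and "A \<noteq> {}" and "finite B"
    and "\<forall>b\<in>B. \<exists>j. odd (b $ j)"
    and "f \<in> signomials A B"
    and "\<exists>k. k simplex (convex hull A)"
    and "real_vec ` B \<subseteq> convex hull A"
    and "\<forall>a\<in>A. \<not> a extreme_point_of (convex hull A) \<longrightarrow> fst f a \<le> 0"
    and "\<forall>b\<in>B. snd f b \<le> 0"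
  shows "(sig_nonneg f \<longleftrightarrow> f \<in> S_cone A B) \<and>
    (sig_nonneg f \<longrightarrow>
      (\<exists>k g. (\<forall>i<k. sig_nonneg (g i) \<and>
                (\<exists>V b. V \<subseteq> {v. v extreme_point_of (convex hull A)} \<and> circuit_function V b (g i))) \<and>
             f = sig_lincomb k (\<lambda>_. 1) g))"
proof -
  obtain C where C: "\<not> affine_dependent C" "convex hull A = convex hull C"
    using assms(6) unfolding simplex_def by blast
  have ext: "v extreme_point_of (convex hull A) \<longleftrightarrow> v \<in> C" for v
    unfolding C(2) using extreme_point_of_convex_hull_affine_independent[OF C(1)] .
  have CA: "C \<subseteq> A" using ext extreme_point_of_convex_hull by blast
  have AC: "A \<subseteq> convex hull C" unfolding C(2)[symmetric] by (rule hull_subset)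
  have decomposition: "\<exists>k g. (\<forall>i<k. g i \<in> signomials A B \<and> AG_function (g i) \<and> sig_nonneg (g i) \<and>
      (\<exists>V b. V \<subseteq> C \<and> circuit_function V b (g i))) \<and> f = sig_lincomb k (\<lambda>_. 1) g"
    if "sig_nonneg f"
    by (rule circuit_decomposition_over_simplex)
      (use C assms that CA AC ext in auto)
  have "f \<in> S_cone A B" if nonneg: "sig_nonneg f"
  proof -
    obtain k g where kg: "\<forall>i<k. g i \<in> signomials A B \<and> AG_function (g i) \<and> sig_nonneg (g i)"
      "f = sig_lincomb k (\<lambda>_. 1) g"
      using decomposition[OF nonneg] by blast
    then have "\<forall>i<k. (0::real) \<le> (\<lambda>_. 1) i \<and> g i \<in> signomials A B \<and> AG_function (g i) \<and> sig_nonneg (g i)"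
      by simp
    then show ?thesis unfolding S_cone_def using kg(2) by blast
  qed
  moreover have "sig_nonneg f" if "f \<in> S_cone A B"
    using that sig_nonneg_lincomb[OF assms(1,3)] unfolding S_cone_def by blast
  moreover have "{v. v extreme_point_of (convex hull A)} = C" using ext by blast
  ultimately show ?thesis using decomposition by blast
qed

end
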